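(* Let $M=(E,\mathcal I)$ be a matroid with weights $\sigma\in\mathbb R^E_{>0}$. Let $\eta^*$ be the universal density of $M$ with weights $\sigma$, and let $E_{\min}$ be the set of elements $e\in E$ at which $\sigma(e)^{-1}\eta^*(e)$ attains its minimal value. Let $H$ be a subset of $E$. If $H\supseteq E_{\min}$, then $D_\sigma(M|H)=D_\sigma(M)$.
   Context: The matroid $M$ is finite, loopless and of positive rank. The universal density of $M$ with weights $\sigma$ is the unique minimizer of $\sum_{e\in E}\sigma(e)^{-1}\eta(e)^2$ over the convex hull in $\mathbb R^E$ of the indicator vectors of the bases of $M$. For a matroid of positive rank with ground set $E$, rank function $r$ and weights $\sigma$, $$D_\sigma(M)=\max\Big\{\tfrac{\sigma(X)}{r(X)}:X\subseteq E,\ r(X)>0\Big\},\qquad \sigma(X)=\sum_{e\in X}\sigma(e).$$ $M|H$ is the restriction of $M$ to $H$, with the restricted weights. *)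

theory Defs
  imports "HOL-Analysis.Analysis" "HOL-Library.Function_Algebras"
begin

record 'a set_system =
  ground :: "'a set"
  indep :: "'a set set"

definition matroid :: "'a set_system \<Rightarrow> bool" where
  "matroid M \<longleftrightarrow>
     finite (ground M) \<and>
     indep M \<subseteq> Pow (ground M) \<and>
     {} \<in> indep M \<and>
     (\<forall>I\<in>indep M. \<forall>J. J \<subseteq> I \<longrightarrow> J \<in> indep M) \<and>
     (\<forall>I\<in>indep M. \<forall>J\<in>indep M. card I < card J \<longrightarrow> (\<exists>e\<in>J - I. insert e I \<in> indep M))"

definition loopless :: "'a set_system \<Rightarrow> bool" where
  "loopless M \<longleftrightarrow> (\<forall>e\<in>ground M. {e} \<in> indep M)"

definition rank_of :: "'a set_system \<Rightarrow> 'a set \<Rightarrow> nat" where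
  "rank_of M X = Max (card ` {I \<in> indep M. I \<subseteq> X})"

definition bases :: "'a set_system \<Rightarrow> 'a set set" where
  "bases M = {B \<in> indep M. \<forall>I\<in>indep M. B \<subseteq> I \<longrightarrow> I = B}"

definition restriction :: "'a set_system \<Rightarrow> 'a set \<Rightarrow> 'a set_system" where
  "restriction M H = \<lparr>ground = H, indep = {I \<in> indep M. I \<subseteq> H}\<rparr>"

text \<open>
  Weights are total functions of which only the values on the ground set are ever used, so the
  restricted weights of \<open>restriction M H\<close> are given by the same function.
\<close>

definition max_density :: "'a set_system \<Rightarrow> ('a \<Rightarrow> real) \<Rightarrow> real" where
  "max_density M \<sigma> = Max {sum \<sigma> X / real (rank_of M X) | X. X \<subseteq> ground M \<and> rank_of M X > 0}"

text \<open>
  The pointwise scalar multiplication makes \<^typ>\<open>'a \<Rightarrow> real\<close> a real vector space, in which the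
  functions vanishing outside a set \<open>E\<close> form the space of real vectors indexed by \<open>E\<close>.
\<close>

instantiation "fun" :: (type, real_vector) real_vector
begin

definition scaleR_fun_def: "r *\<^sub>R f = (\<lambda>x. r *\<^sub>R f x)"

instance
  by standard (auto simp: scaleR_fun_def fun_eq_iff scaleR_add_right scaleR_add_left)

end

text \<open>Indicators of bases vanish outside the ground set, hence so does every point of the hull.\<close>

definition base_polytope :: "'a set_system \<Rightarrow> ('a \<Rightarrow> real) set" where
  "base_polytope M = convex hull (indicator ` bases M)"

definition energy :: "'a set_system \<Rightarrow> ('a \<Rightarrow> real) \<Rightarrow> ('a \<Rightarrow> real) \<Rightarrow> real" where
  "energy M \<sigma> \<eta> = (\<Sum>e\<in>ground M. inverse (\<sigma> e) * (\<eta> e)\<^sup>2)"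

definition universal_density :: "'a set_system \<Rightarrow> ('a \<Rightarrow> real) \<Rightarrow> 'a \<Rightarrow> real" where
  "universal_density M \<sigma> =
     (THE \<eta>. is_arg_min (energy M \<sigma>) (\<lambda>\<eta>. \<eta> \<in> base_polytope M) \<eta>)"

definition E_min :: "'a set_system \<Rightarrow> ('a \<Rightarrow> real) \<Rightarrow> 'a set" where
  "E_min M \<sigma> =
     {e. is_arg_min (\<lambda>e. inverse (\<sigma> e) * universal_density M \<sigma> e) (\<lambda>e. e \<in> ground M) e}"

lemma finite_indep: "matroid M \<Longrightarrow> finite (indep M)"
  by (rule finite_subset[of _ "Pow (ground M)"]) (auto simp: matroid_def)

lemma finite_bases: "matroid M \<Longrightarrow> finite (bases M)"
  unfolding bases_def by (rule finite_subset[OF _ finite_indep]) auto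

lemma bases_nonempty:
  assumes "matroid M"
  shows "bases M \<noteq> {}"
proof -
  have "indep M \<noteq> {}" using assms unfolding matroid_def by auto
  with finite_indep[OF assms] obtain B where "B \<in> indep M" "\<forall>I\<in>indep M. B \<subseteq> I \<longrightarrow> B = I"
    using finite_has_maximal by metis
  then show ?thesis unfolding bases_def by auto
qed

lemma base_polytope_zero:
  assumes "matroid M" "\<eta> \<in> base_polytope M" "e \<notin> ground M"
  shows "\<eta> e = 0"
proof -
  have "convex {f :: 'a \<Rightarrow> real. f e = 0}"
    by (auto simp: convex_def scaleR_fun_def)
  moreover have "indicator ` bases M \<subseteq> {f :: 'a \<Rightarrow> real. f e = 0}"
  proof (rule image_subsetI)
    fix B assume "B \<in> bases M"
    then have "B \<subseteq> ground M"
      using assms(1) by (auto simp: bases_def matroid_def)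
    then show "indicator B \<in> {f :: 'a \<Rightarrow> real. f e = 0}"
      using assms(3) by (auto simp: indicator_eq_0_iff)
  qed
  ultimately have "base_polytope M \<subseteq> {f. f e = 0}"
    unfolding base_polytope_def by (intro hull_minimal)
  then show ?thesis
    using assms(2) by auto
qed

lemma compact_hull_fun:
  fixes S :: "('a \<Rightarrow> real) set"
  assumes "finite S"
  shows "compact (convex hull S)"
  using assms
proof (induction S rule: finite_induct)
  case empty
  then show ?case by simp
next
  case (insert a S)
  show ?case
  proof (cases "S = {}")
    case True
    then show ?thesis by simp
  next
    case False
    define f where "f = (\<lambda>p :: real \<times> ('a \<Rightarrow> real). (\<lambda>x. (1 - fst p) * a x + fst p * snd p x))"
    have f: "(1 - u) *\<^sub>R a + u *\<^sub>R b = f (u, b)" for u b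
      by (simp add: f_def scaleR_fun_def plus_fun_def)
    have eq: "convex hull (insert a S) = f ` ({0..1} \<times> (convex hull S))"
    proof -
      have "convex hull (insert a S) =
          {f (u, b) |b u. 0 \<le> u \<and> u \<le> 1 \<and> b \<in> convex hull S}"
        unfolding convex_hull_insert_alt f using False by simp
      also have "\<dots> = f ` ({0..1} \<times> (convex hull S))"
        by force
      finally show ?thesis .
    qed
    have cont: "continuous_on ({0..1} \<times> (convex hull S)) f"
    proof (rule continuous_on_coordinatewise_then_product)
      fix x
      have "continuous_on ({0..1} \<times> (convex hull S)) (\<lambda>p :: real \<times> ('a \<Rightarrow> real). snd p x)"
        by (rule continuous_on_product_then_coordinatewise[OF continuous_on_snd[OF continuous_on_id]])
      then show "continuous_on ({0..1} \<times> (convex hull S)) (\<lambda>p. f p x)"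
        unfolding f_def
        by (intro continuous_on_add continuous_on_mult continuous_on_diff continuous_on_const
            continuous_on_fst continuous_on_id)
    qed
    show ?thesis
      unfolding eq by (rule compact_continuous_image[OF cont compact_Times[OF compact_Icc insert.IH]])
  qed
qed

text \<open>The description in \<^const>\<open>universal_density\<close> determines exactly one vector.\<close>

lemma ex1_minimizer:
  assumes M: "matroid M" and pos: "\<And>e. e \<in> ground M \<Longrightarrow> \<sigma> e > 0"
  shows "\<exists>!\<eta>. is_arg_min (energy M \<sigma>) (\<lambda>\<eta>. \<eta> \<in> base_polytope M) \<eta>"
proof (rule ex_ex1I)
  have c: "compact (base_polytope M)"
    unfolding base_polytope_def using compact_hull_fun finite_bases[OF M] by blast
  have ne: "base_polytope M \<noteq> {}"
    unfolding base_polytope_def using bases_nonempty[OF M] by simp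
  have co: "continuous_on (base_polytope M) (energy M \<sigma>)"
    unfolding energy_def
    by (intro continuous_intros
        continuous_on_subset[OF continuous_on_product_coordinates subset_UNIV])
  from continuous_attains_inf[OF c ne co]
  show "\<exists>\<eta>. is_arg_min (energy M \<sigma>) (\<lambda>\<eta>. \<eta> \<in> base_polytope M) \<eta>"
    unfolding is_arg_min_linorder by blast
next
  fix \<eta> \<zeta>
  assume "is_arg_min (energy M \<sigma>) (\<lambda>\<eta>. \<eta> \<in> base_polytope M) \<eta>"
    and "is_arg_min (energy M \<sigma>) (\<lambda>\<eta>. \<eta> \<in> base_polytope M) \<zeta>"
  then have P: "\<eta> \<in> base_polytope M" "\<zeta> \<in> base_polytope M"
    and min: "\<And>\<xi>. \<xi> \<in> base_polytope M \<Longrightarrow> energy M \<sigma> \<eta> \<le> energy M \<sigma> \<xi>"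
      "\<And>\<xi>. \<xi> \<in> base_polytope M \<Longrightarrow> energy M \<sigma> \<zeta> \<le> energy M \<sigma> \<xi>"
    unfolding is_arg_min_linorder by auto
  have fin: "finite (ground M)"
    using M unfolding matroid_def by simp
  define \<xi> where "\<xi> = (1/2) *\<^sub>R \<eta> + (1/2) *\<^sub>R \<zeta>"
  have "\<xi> \<in> base_polytope M"
    unfolding \<xi>_def using P unfolding base_polytope_def
    by (intro convexD[OF convex_convex_hull]) auto
  from min(1)[OF this] min(2)[OF this]
  have le: "energy M \<sigma> \<eta> + energy M \<sigma> \<zeta> \<le> 2 * energy M \<sigma> \<xi>"
    by simp
  have parallelogram: "2 * (c * (x / 2 + y / 2)\<^sup>2) = c * x\<^sup>2 + c * y\<^sup>2 - c * ((x - y)\<^sup>2 / 2)"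
    for c x y :: real
    by (simp add: power2_eq_square field_simps)
  have \<xi>_apply: "\<xi> e = \<eta> e / 2 + \<zeta> e / 2" for e
    by (simp add: \<xi>_def scaleR_fun_def)
  have "2 * energy M \<sigma> \<xi> =
      energy M \<sigma> \<eta> + energy M \<sigma> \<zeta>
        - (\<Sum>e\<in>ground M. inverse (\<sigma> e) * ((\<eta> e - \<zeta> e)\<^sup>2 / 2))"
    unfolding energy_def sum_distrib_left \<xi>_apply parallelogram
    by (simp only: sum_subtractf sum.distrib)
  with le have "(\<Sum>e\<in>ground M. inverse (\<sigma> e) * ((\<eta> e - \<zeta> e)\<^sup>2 / 2)) \<le> 0" by simp
  moreover have nn: "inverse (\<sigma> e) * ((\<eta> e - \<zeta> e)\<^sup>2 / 2) \<ge> 0" if "e \<in> ground M" for e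
    using pos[OF that] by simp
  ultimately have "(\<Sum>e\<in>ground M. inverse (\<sigma> e) * ((\<eta> e - \<zeta> e)\<^sup>2 / 2)) = 0"
    by (rule order_antisym[OF _ sum_nonneg])
  then have zero: "\<forall>e\<in>ground M. inverse (\<sigma> e) * ((\<eta> e - \<zeta> e)\<^sup>2 / 2) = 0"
    using sum_nonneg_eq_0_iff[of "ground M", OF fin nn] by simp
  have "\<eta> e = \<zeta> e" if "e \<in> ground M" for e
    using bspec[OF zero that] pos[OF that] by simp
  moreover have "\<eta> e = \<zeta> e" if "e \<notin> ground M" for e
    using base_polytope_zero[OF M P(1) that] base_polytope_zero[OF M P(2) that] by simp
  ultimately show "\<eta> = \<zeta>" by (intro ext) blast
qed

lemma universal_density_is_arg_min:
  assumes "matroid M" and "\<And>e. e \<in> ground M \<Longrightarrow> \<sigma> e > 0"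
  shows "is_arg_min (energy M \<sigma>) (\<lambda>\<eta>. \<eta> \<in> base_polytope M) (universal_density M \<sigma>)"
  unfolding universal_density_def by (rule theI'[OF ex1_minimizer[OF assms]])

end

theory Submission
  imports Defs
begin

text \<open>
  Write \<open>\<eta>\<close> for the universal density, \<open>w = \<eta> / \<sigma>\<close>, and \<open>m\<close> for the least value of \<open>w\<close>.  The
  theorem holds because \<open>E_min\<close> itself is a densest set, so every restriction that contains it still
  sees the maximal density, which turns out to be \<open>1 / m\<close>.

  The upper bound is duality: every point of the base polytope satisfies \<open>\<eta>(X) \<le> r(X)\<close>, hence
  \<open>m \<sigma>(X) \<le> \<eta>(X) \<le> r(X)\<close> for all \<open>X\<close>.  At \<open>X = E_min\<close> the first inequality is an equality by
  definition, so the heart of the matter is that the second one is too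
  (\<open>universal_density_tight\<close>).  Up to a factor, \<open>w\<close> is the gradient of the energy at \<open>\<eta>\<close>, so
  \<open>\<eta>\<close> minimizes the linear functional \<open>w\<close> over the base polytope
  (\<open>universal_density_first_order\<close>) and is therefore a convex combination of bases of least
  \<open>w\<close>-weight (\<open>convex_hull_minimal_face\<close>).  As in the greedy algorithm, such a base contains as many
  elements of the lightest class \<open>E_min\<close> as any independent set can (\<open>min_weight_base_meets\<close>), so
  each of them contributes exactly \<open>r(E_min)\<close>.  Looplessness gives \<open>r(E_min) > 0\<close>, which forces
  \<open>m > 0\<close>.
\<close>

section \<open>Independent sets and bases\<close>

lemma matroid_finite_indep:
  "matroid M \<Longrightarrow> I \<in> indep M \<Longrightarrow> finite I"
  unfolding matroid_def by (meson PowD finite_subset subsetD)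

lemma indep_subset_closed:
  "matroid M \<Longrightarrow> I \<in> indep M \<Longrightarrow> J \<subseteq> I \<Longrightarrow> J \<in> indep M"
  unfolding matroid_def by simp

lemma base_indep: "B \<in> bases M \<Longrightarrow> B \<in> indep M"
  by (simp add: bases_def)

lemma base_subset_ground: "matroid M \<Longrightarrow> B \<in> bases M \<Longrightarrow> B \<subseteq> ground M"
  unfolding bases_def matroid_def by auto

lemma card_le_rank_of:
  assumes "matroid M" "I \<in> indep M" "I \<subseteq> X"
  shows "card I \<le> rank_of M X"
  unfolding rank_of_def using assms finite_indep[OF assms(1)] by (intro Max_ge) auto

lemma rank_of_attained:
  assumes "matroid M"
  obtains I where "I \<in> indep M" "I \<subseteq> X" "card I = rank_of M X"
proof -
  have "rank_of M X \<in> card ` {I \<in> indep M. I \<subseteq> X}"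
    unfolding rank_of_def using assms finite_indep[OF assms]
    by (intro Max_in) (auto simp: matroid_def)
  then show thesis using that by auto
qed

lemma card_indep_le_base:
  assumes M: "matroid M" and B: "B \<in> bases M" and I: "I \<in> indep M"
  shows "card I \<le> card B"
proof (rule ccontr)
  assume "\<not> card I \<le> card B"
  moreover note base_indep[OF B]
  ultimately obtain e where "e \<in> I - B" "insert e B \<in> indep M"
    using M I unfolding matroid_def by (meson not_le)
  then show False using B unfolding bases_def by blast
qed

lemma base_if_card_eq:
  assumes M: "matroid M" and B: "B \<in> bases M" and I: "I \<in> indep M" "card I = card B"
  shows "I \<in> bases M"
proof -
  have "J = I" if "J \<in> indep M" "I \<subseteq> J" for J
    using card_indep_le_base[OF M B that(1)] I(2) card_seteq[of J I]
      matroid_finite_indep[OF M that(1)] that(2) by auto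
  then show ?thesis using I(1) by (simp add: bases_def)
qed

lemma indep_extend_within:
  assumes M: "matroid M" and I: "I \<in> indep M" and J: "J \<in> indep M" and "card I \<le> card J"
  obtains K where "K \<in> indep M" "I \<subseteq> K" "K \<subseteq> I \<union> J" "card K = card J"
proof -
  have "\<exists>K\<in>indep M. I \<subseteq> K \<and> K \<subseteq> I \<union> J \<and> card K = card J"
    using I \<open>card I \<le> card J\<close>
  proof (induction "card J - card I" arbitrary: I)
    case 0
    then show ?case by auto
  next
    case (Suc n)
    then have "card I < card J" by simp
    then obtain e where e: "e \<in> J - I" "insert e I \<in> indep M"
      using M J Suc.prems(1) unfolding matroid_def by meson
    have "card (insert e I) = Suc (card I)"
      using e matroid_finite_indep[OF M Suc.prems(1)] by simp
    then have "\<exists>K\<in>indep M. insert e I \<subseteq> K \<and> K \<subseteq> insert e I \<union> J \<and> card K = card J"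
      using Suc.hyps(2) \<open>card I < card J\<close> by (intro Suc.hyps(1) e(2)) linarith+
    then obtain K where "K \<in> indep M" "insert e I \<subseteq> K" "K \<subseteq> insert e I \<union> J" "card K = card J"
      by blast
    then show ?case using e(1) by blast
  qed
  then show thesis using that by blast
qed

section \<open>Bases of least weight\<close>

text \<open>
  Otherwise \<open>B \<inter> A\<close> could be augmented by some \<open>e\<close> of \<open>A\<close>; completing the result to a base inside
  \<open>insert e B\<close> exchanges an element of \<open>B\<close> outside \<open>A\<close> for the strictly lighter \<open>e\<close>.
\<close>

lemma min_weight_base_meets:
  fixes w :: "'a \<Rightarrow> real"
  assumes M: "matroid M" and B: "B \<in> bases M"
    and min: "\<And>B'. B' \<in> bases M \<Longrightarrow> sum w B \<le> sum w B'"
    and light: "\<And>e f. e \<in> A \<Longrightarrow> f \<in> ground M - A \<Longrightarrow> w e < w f"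
  shows "card (B \<inter> A) = rank_of M A"
proof (rule ccontr)
  assume ne: "card (B \<inter> A) \<noteq> rank_of M A"
  note Bi = base_indep[OF B]
  have finB: "finite B" using matroid_finite_indep[OF M Bi] .
  have BA: "B \<inter> A \<in> indep M" using indep_subset_closed[OF M Bi] by simp
  have lt: "card (B \<inter> A) < rank_of M A"
    using card_le_rank_of[OF M BA, of A] ne by simp
  obtain I where I: "I \<in> indep M" "I \<subseteq> A" "card I = rank_of M A"
    using rank_of_attained[OF M] .
  obtain e where e: "e \<in> I - B \<inter> A" and ei: "insert e (B \<inter> A) \<in> indep M"
    using M BA I(1) lt unfolding I(3)[symmetric] matroid_def by meson
  have eA: "e \<in> A" and eB: "e \<notin> B" using e I(2) by auto
  obtain K where K: "K \<in> indep M" "insert e (B \<inter> A) \<subseteq> K" "K \<subseteq> insert e (B \<inter> A) \<union> B"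
    "card K = card B"
    using indep_extend_within[OF M ei Bi card_indep_le_base[OF M B ei]] .
  have Kb: "K \<in> bases M" using base_if_card_eq[OF M B K(1,4)] .
  have finK: "finite K" using matroid_finite_indep[OF M K(1)] .
  have KB: "K - {e} \<subseteq> B" using K(3) by auto
  have "card (K - {e}) < card B"
    using K(2,4) finK by (metis card_Diff1_less insert_subset)
  then have "card (B - (K - {e})) = 1"
    using K(2,4) finB finK KB by (simp add: card_Diff_subset)
  then obtain f where f: "B - (K - {e}) = {f}" by (auto simp: card_1_singleton_iff)
  have fA: "f \<in> ground M - A"
    using f K(2) eB base_subset_ground[OF M B] by blast
  have "sum w K = w e + sum w (K - {e})"
    using finK K(2) by (simp add: sum.remove)
  moreover have "sum w B = w f + sum w (K - {e})"
    using sum.subset_diff[OF KB finB, of w] f by simp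
  ultimately show False using min[OF Kb] light[OF eA fA] by simp
qed

section \<open>Linear functionals on the base polytope\<close>

text \<open>
  In a convex combination equal to the minimum of \<open>F\<close>, a vertex at which \<open>F\<close> is larger must carry
  coefficient zero.
\<close>

lemma convex_hull_minimal_face:
  fixes F :: "'v::real_vector \<Rightarrow> real"
  assumes fin: "finite S" and F: "linear F" and y: "y \<in> convex hull S"
    and min: "\<And>x. x \<in> S \<Longrightarrow> F y \<le> F x"
  shows "y \<in> convex hull {x \<in> S. F x = F y}"
proof -
  obtain u where u: "\<forall>x\<in>S. 0 \<le> u x" "sum u S = 1" "(\<Sum>x\<in>S. u x *\<^sub>R x) = y"
    using y unfolding convex_hull_finite[OF fin] by auto
  have "F y = (\<Sum>x\<in>S. u x * F x)"
    unfolding u(3)[symmetric] linear_sum[OF F] linear_scale[OF F] by simp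
  then have "(\<Sum>x\<in>S. u x * (F x - F y)) = 0"
    using u(2) by (simp add: right_diff_distrib sum_subtractf flip: sum_distrib_right)
  then have "\<forall>x\<in>S. u x * (F x - F y) = 0"
    using fin u(1) min by (subst (asm) sum_nonneg_eq_0_iff) auto
  then have zero: "u x = 0" if "x \<in> S - {x \<in> S. F x = F y}" for x
    using that by auto
  have "sum u {x \<in> S. F x = F y} = 1"
    using u(2) zero by (subst sum.mono_neutral_left[OF fin]) auto
  moreover have "(\<Sum>x\<in>{x \<in> S. F x = F y}. u x *\<^sub>R x) = y"
    using u(3) zero by (subst sum.mono_neutral_left[OF fin]) auto
  moreover have "finite {x \<in> S. F x = F y}" using fin by simp
  ultimately show ?thesis
    using u(1) by (subst convex_hull_finite) auto
qed

lemma linear_weighted_sum: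
  "linear (\<lambda>x :: 'a \<Rightarrow> real. \<Sum>e\<in>A. w e * x e :: real)"
  by (rule linearI)
    (simp_all add: scaleR_fun_def distrib_left sum.distrib sum_distrib_left mult.left_commute)

lemma weighted_sum_indicator:
  assumes "finite A"
  shows "(\<Sum>e\<in>A. w e * indicator B e) = (sum w (B \<inter> A) :: real)"
proof -
  have "(\<Sum>e\<in>A. w e * indicator B e) = (\<Sum>e\<in>A. if e \<in> B then w e else 0)"
    by (intro sum.cong) auto
  also have "\<dots> = sum w (A \<inter> B)" by (rule sum.inter_restrict[OF assms, symmetric])
  finally show ?thesis by (simp add: Int_commute)
qed

lemma base_polytope_nonneg:
  assumes "\<eta> \<in> base_polytope M"
  shows "0 \<le> \<eta> e"
proof -
  have "base_polytope M \<subseteq> {f. 0 \<le> f e}"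
    unfolding base_polytope_def
    by (intro hull_minimal) (auto simp: convex_def scaleR_fun_def)
  then show ?thesis using assms by auto
qed

lemma base_polytope_sum_le_rank:
  assumes M: "matroid M" and \<eta>: "\<eta> \<in> base_polytope M" and X: "X \<subseteq> ground M"
  shows "sum \<eta> X \<le> rank_of M X"
proof -
  have finX: "finite X" using finite_subset[OF X] M by (simp add: matroid_def)
  have lin: "linear (\<lambda>f :: 'a \<Rightarrow> real. sum f X)"
    using linear_weighted_sum[of "\<lambda>_. 1" X] by simp
  have "convex {f :: 'a \<Rightarrow> real. sum f X \<le> rank_of M X}"
    using convex_linear_vimage[OF lin convex_real_interval(2)[of "rank_of M X"]]
    by (simp add: vimage_def)
  moreover have "sum (indicator B) X \<le> real (rank_of M X)" if "B \<in> bases M" for B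
  proof -
    have "B \<inter> X \<in> indep M"
      using indep_subset_closed[OF M base_indep[OF that]] by simp
    from card_le_rank_of[OF M this, of X] show ?thesis
      using weighted_sum_indicator[OF finX, of "\<lambda>_. 1" B] by simp
  qed
  ultimately have "base_polytope M \<subseteq> {f. sum f X \<le> rank_of M X}"
    unfolding base_polytope_def by (intro hull_minimal) auto
  then show ?thesis using \<eta> by auto
qed

section \<open>Optimality of the universal density\<close>

text \<open>
  Moving from \<open>\<eta>\<close> towards \<open>\<zeta>\<close> stays in the polytope, and along that segment the energy is a quadratic
  polynomial minimal at its left end, so its derivative there is nonnegative.
\<close>

lemma universal_density_first_order:
  assumes M: "matroid M" and pos: "\<And>e. e \<in> ground M \<Longrightarrow> \<sigma> e > 0"
    and \<zeta>: "\<zeta> \<in> base_polytope M"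
  defines "\<eta> \<equiv> universal_density M \<sigma>"
  shows "(\<Sum>e\<in>ground M. inverse (\<sigma> e) * \<eta> e * \<eta> e)
    \<le> (\<Sum>e\<in>ground M. inverse (\<sigma> e) * \<eta> e * \<zeta> e)"
proof -
  have \<eta>: "\<eta> \<in> base_polytope M"
    and min: "\<And>\<xi>. \<xi> \<in> base_polytope M \<Longrightarrow> energy M \<sigma> \<eta> \<le> energy M \<sigma> \<xi>"
    using universal_density_is_arg_min[OF M pos] unfolding \<eta>_def is_arg_min_linorder by auto
  define a where "a = (\<Sum>e\<in>ground M. inverse (\<sigma> e) * \<eta> e * (\<zeta> e - \<eta> e))"
  define b where "b = (\<Sum>e\<in>ground M. inverse (\<sigma> e) * (\<zeta> e - \<eta> e)\<^sup>2)"
  have b: "0 \<le> b"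
    unfolding b_def by (intro sum_nonneg) (simp add: pos less_imp_le)
  have step: "0 \<le> 2 * a + t * b" if t: "0 < t" "t \<le> 1" for t
  proof -
    have "(1 - t) *\<^sub>R \<eta> + t *\<^sub>R \<zeta> \<in> base_polytope M"
      using \<eta> \<zeta> t unfolding base_polytope_def by (intro convexD[OF convex_convex_hull]) auto
    note min[OF this]
    also have "energy M \<sigma> ((1 - t) *\<^sub>R \<eta> + t *\<^sub>R \<zeta>)
        = (\<Sum>e\<in>ground M. inverse (\<sigma> e) * (\<eta> e)\<^sup>2
            + t * (2 * (inverse (\<sigma> e) * \<eta> e * (\<zeta> e - \<eta> e))
                + t * (inverse (\<sigma> e) * (\<zeta> e - \<eta> e)\<^sup>2)))"
      unfolding energy_def
      by (intro sum.cong refl) (simp add: scaleR_fun_def power2_eq_square algebra_simps)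
    also have "\<dots> = energy M \<sigma> \<eta> + t * (2 * a + t * b)"
      unfolding energy_def a_def b_def by (simp add: sum.distrib flip: sum_distrib_left)
    finally show ?thesis using t(1) by (simp add: zero_le_mult_iff)
  qed
  have "0 \<le> a"
  proof (rule ccontr)
    assume "\<not> 0 \<le> a"
    then have a: "a < 0" by simp
    \<comment> \<open>A step so short that the quadratic term is at most half of the linear one.\<close>
    define t where "t = min 1 (- a / (b + 1))"
    have "0 < t" "t \<le> 1" using a b by (auto simp: t_def divide_neg_pos)
    moreover have "t * b \<le> - a"
    proof -
      have "t * b \<le> - a / (b + 1) * b"
        using b by (intro mult_right_mono) (auto simp: t_def)
      also have "\<dots> \<le> - a" using a b by (simp add: field_simps)
      finally show ?thesis .
    qed
    ultimately show False using step[of t] a by linarith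
  qed
  then show ?thesis unfolding a_def by (simp add: right_diff_distrib sum_subtractf)
qed

lemma universal_density_tight:
  assumes M: "matroid M" and pos: "\<And>e. e \<in> ground M \<Longrightarrow> \<sigma> e > 0"
  shows "sum (universal_density M \<sigma>) (E_min M \<sigma>) = rank_of M (E_min M \<sigma>)"
proof -
  define \<eta> where "\<eta> = universal_density M \<sigma>"
  define w where "w e = inverse (\<sigma> e) * \<eta> e" for e
  define F where "F x = (\<Sum>e\<in>ground M. w e * x e)" for x :: "'a \<Rightarrow> real"
  let ?A = "E_min M \<sigma>"
  have finE: "finite (ground M)" using M by (simp add: matroid_def)
  have AE: "?A \<subseteq> ground M" unfolding E_min_def is_arg_min_def by auto
  have light: "w e < w f" if "e \<in> ?A" "f \<in> ground M - ?A" for e f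
    using that unfolding E_min_def is_arg_min_linorder w_def \<eta>_def by force
  have lin: "linear F" unfolding F_def by (rule linear_weighted_sum)
  have \<eta>: "\<eta> \<in> base_polytope M"
    using universal_density_is_arg_min[OF M pos] unfolding \<eta>_def is_arg_min_linorder by auto
  have F\<eta>: "F \<eta> \<le> F \<zeta>" if "\<zeta> \<in> base_polytope M" for \<zeta>
    using universal_density_first_order[OF M pos that] unfolding F_def w_def \<eta>_def by simp
  have ind: "indicator B \<in> base_polytope M" if "B \<in> bases M" for B
    using that unfolding base_polytope_def by (simp add: hull_inc)
  have FB: "F (indicator B) = sum w B" if "B \<in> bases M" for B
  proof -
    have "B \<inter> ground M = B" using base_subset_ground[OF M that] by blast
    then show ?thesis unfolding F_def by (simp add: weighted_sum_indicator[OF finE])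
  qed
  have face: "\<eta> \<in> convex hull {x \<in> indicator ` bases M. F x = F \<eta>}"
    using finite_bases[OF M] lin \<eta> F\<eta> ind unfolding base_polytope_def
    by (intro convex_hull_minimal_face) auto
  have on_face: "sum (indicator B) ?A = real (rank_of M ?A)"
    if B: "B \<in> bases M" and "F (indicator B) = F \<eta>" for B
  proof -
    have "sum w B \<le> sum w B'" if "B' \<in> bases M" for B'
      using F\<eta>[OF ind[OF that]] \<open>F (indicator B) = F \<eta>\<close> FB[OF B] FB[OF that] by simp
    then have "card (B \<inter> ?A) = rank_of M ?A"
      using light by (rule min_weight_base_meets[OF M B])
    then show ?thesis
      using weighted_sum_indicator[of ?A "\<lambda>_. 1" B] finite_subset[OF AE finE] by simp
  qed
  have linA: "linear (\<lambda>f :: 'a \<Rightarrow> real. sum f ?A)"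
    using linear_weighted_sum[of "\<lambda>_. 1" ?A] by simp
  have "convex {f :: 'a \<Rightarrow> real. sum f ?A = rank_of M ?A}"
    using convex_linear_vimage[OF linA convex_singleton[of "real (rank_of M ?A)"]]
    by (simp add: vimage_def)
  then have "convex hull {x \<in> indicator ` bases M. F x = F \<eta>}
      \<subseteq> {f. sum f ?A = rank_of M ?A}"
    using on_face by (intro hull_minimal) auto
  then show ?thesis using face unfolding \<eta>_def by auto
qed

section \<open>Maximal density\<close>

lemma rank_of_restriction:
  "X \<subseteq> H \<Longrightarrow> rank_of (restriction M H) X = rank_of M X"
  unfolding rank_of_def restriction_def
  by (rule arg_cong[where f = "\<lambda>S. Max (card ` S)"]) auto

text \<open>
  Duality bounds every density by \<open>1 / m\<close>, where \<open>m\<close> is the least value of \<open>\<eta> / \<sigma>\<close>, and tightness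
  makes \<open>E_min\<close> attain the bound.  As the value does not depend on \<open>H\<close>, comparing \<open>H\<close> with the
  whole ground set shows that the maximal density of the matroid survives the restriction.
\<close>

lemma max_density_restriction_E_min:
  assumes M: "matroid M" and loopless: "loopless M" and nonempty: "ground M \<noteq> {}"
    and pos: "\<And>e. e \<in> ground M \<Longrightarrow> \<sigma> e > 0"
    and H: "E_min M \<sigma> \<subseteq> H" "H \<subseteq> ground M"
  shows "max_density (restriction M H) \<sigma> = sum \<sigma> (E_min M \<sigma>) / rank_of M (E_min M \<sigma>)"
proof -
  define \<eta> where "\<eta> = universal_density M \<sigma>"
  define w where "w e = inverse (\<sigma> e) * \<eta> e" for e
  define m where "m = Min (w ` ground M)"
  let ?A = "E_min M \<sigma>"
  have finE: "finite (ground M)" using M by (simp add: matroid_def)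
  have \<eta>: "\<eta> \<in> base_polytope M"
    using universal_density_is_arg_min[OF M pos] unfolding \<eta>_def is_arg_min_linorder by auto
  have m_le: "m \<le> w e" if "e \<in> ground M" for e
    using that finE by (simp add: m_def)
  have \<eta>w: "\<eta> e = w e * \<sigma> e" if "e \<in> ground M" for e
    using pos[OF that] by (simp add: w_def)
  have "m \<in> w ` ground M" unfolding m_def using finE nonempty by (intro Min_in) auto
  then obtain a where a: "a \<in> ground M" "w a = m" by auto
  have aA: "a \<in> ?A"
    using a m_le unfolding E_min_def is_arg_min_linorder w_def \<eta>_def by auto
  have wA: "w e = m" if "e \<in> ?A" for e
    using that a m_le[of e] unfolding E_min_def is_arg_min_linorder w_def \<eta>_def by force
  have "sum \<eta> ?A = rank_of M ?A"
    using universal_density_tight[OF M pos] unfolding \<eta>_def .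
  moreover have "sum \<eta> ?A = m * sum \<sigma> ?A"
    unfolding sum_distrib_left using H \<eta>w wA by (intro sum.cong) auto
  ultimately have tight: "m * sum \<sigma> ?A = rank_of M ?A" by simp
  have rank_pos: "0 < rank_of M ?A"
    using card_le_rank_of[OF M, of "{a}" ?A] loopless a(1) aA by (simp add: loopless_def)
  have "0 \<le> m"
    using base_polytope_nonneg[OF \<eta>, of a] pos[OF a(1)] a(2) by (simp add: w_def flip: a(2))
  moreover have "m \<noteq> 0" using tight rank_pos by auto
  ultimately have m: "0 < m" by simp
  have density_A: "sum \<sigma> ?A / rank_of M ?A = 1 / m"
    using tight rank_pos m by (simp add: field_simps)
  have le: "sum \<sigma> X / rank_of M X \<le> 1 / m" if "X \<subseteq> ground M" "0 < rank_of M X" for X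
  proof -
    have "m * sum \<sigma> X \<le> sum \<eta> X"
      unfolding sum_distrib_left
    proof (rule sum_mono)
      fix e assume "e \<in> X"
      then have "e \<in> ground M" using that(1) by blast
      then show "m * \<sigma> e \<le> \<eta> e"
        using \<eta>w m_le pos by (simp add: mult_right_mono less_imp_le)
    qed
    also have "\<dots> \<le> rank_of M X" using base_polytope_sum_le_rank[OF M \<eta> that(1)] .
    finally show ?thesis using m that(2) by (simp add: field_simps)
  qed
  have "max_density (restriction M H) \<sigma>
      = Max {sum \<sigma> X / rank_of M X | X. X \<subseteq> H \<and> 0 < rank_of M X}"
  proof -
    have "ground (restriction M H) = H" by (simp add: restriction_def)
    then have "{sum \<sigma> X / rank_of (restriction M H) X | X.
          X \<subseteq> ground (restriction M H) \<and> 0 < rank_of (restriction M H) X}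
        = {sum \<sigma> X / rank_of M X | X. X \<subseteq> H \<and> 0 < rank_of M X}"
      using rank_of_restriction[of _ H M] by (intro Collect_cong) (metis (no_types))
    then show ?thesis unfolding max_density_def by simp
  qed
  also have "\<dots> = sum \<sigma> ?A / rank_of M ?A"
  proof (rule Max_eqI)
    show "finite {sum \<sigma> X / rank_of M X | X. X \<subseteq> H \<and> 0 < rank_of M X}"
      using finite_subset[OF H(2) finE] by simp
    show "sum \<sigma> ?A / rank_of M ?A
        \<in> {sum \<sigma> X / rank_of M X | X. X \<subseteq> H \<and> 0 < rank_of M X}"
      using H(1) rank_pos by blast
  qed (use H(2) le density_A in auto)
  finally show ?thesis .
qed

theorem lemma6p5:
  fixes M :: "'a set_system" and \<sigma> :: "'a \<Rightarrow> real" and H :: "'a set"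
  assumes "matroid M"
    and "loopless M"
    and "rank_of M (ground M) > 0"
    and "\<forall>e\<in>ground M. \<sigma> e > 0"
    and "H \<subseteq> ground M"
    and "E_min M \<sigma> \<subseteq> H"
  shows "max_density (restriction M H) \<sigma> = max_density M \<sigma>"
proof -
  have nonempty: "ground M \<noteq> {}"
  proof
    assume "ground M = {}"
    moreover obtain I where "I \<subseteq> ground M" "card I = rank_of M (ground M)"
      using rank_of_attained[OF assms(1)] .
    ultimately show False using assms(3) by simp
  qed
  have "restriction M (ground M) = M"
    using assms(1) unfolding restriction_def matroid_def
    by (intro set_system.equality) auto
  moreover have "max_density (restriction M H') \<sigma>
      = sum \<sigma> (E_min M \<sigma>) / rank_of M (E_min M \<sigma>)"
    if "E_min M \<sigma> \<subseteq> H'" "H' \<subseteq> ground M" for H'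
    using max_density_restriction_E_min[OF assms(1,2) nonempty _ that] assms(4) by simp
  note this[OF assms(6,5)] this[OF subset_trans[OF assms(6,5)] subset_refl]
  ultimately show ?thesis by simp
qed

end
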